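(* Consider a robot system with compact surveillance space $X$ whose interpreted system $\mathcal{I}$ satisfies the simple exploration conditions for the surveillance cylinder $X\times[0,1]$, the found and secure conditions, and, for a run $\rho$, the manifold liveness condition. Then the surveillance task is solved at $\rho$, i.e. $\mathcal{I},\rho\models\Diamond\,\mathrm{FOUND}\vee\Diamond\,\mathrm{SECURE}$.
   Context: $\Pi$ is a finite set of robots; $X\subseteq[0,1]^k$ is compact with Euclidean topology and $C=X\times[0,1]$ (product topology) is the surveillance cylinder (space × normalized time frame). An interpreted system $\mathcal{I}$ is a set of runs, each a sequence of global configurations indexed by discrete time $[t]\in\mathbb{N}$; points are pairs $(\rho,[t])$; $(\rho,[t])\sim_r(\rho',[t'])$ iff robot $r$ has the same epistemic state at both, $\sim_{D_A}=\bigcap_{r\in A}\sim_r$. Atoms: $\mathrm{sp}(U)$ for open $U\subseteq C$ ("$U$ has been explored and no intruder was found there"), with $\mathrm{sp}(V)\to\mathrm{sp}(U)$ for $U\subseteq V$ and finitely many true $\mathrm{sp}(V_i)$ entailing $\mathrm{sp}(\bigcup V_i)$; plus atoms $\mathrm{FOUND}$ and $\mathrm{SECURE}$. Semantics: $K_r,D_A$ quantify over $\sim_r$, $\sim_{D_A}$-related points; $\Diamond\varphi$ at $(\rho,[t])$ iff $\varphi$ at $(\rho,[t'])$ for some $[t']\ge[t]$; $\Box=\neg\Diamond\neg$; $\mathcal{I},\rho\models\Diamond\varphi$ iff $\varphi$ holds at some point of $\rho$. Simple exploration conditions (for open $U\subseteq C$, robots $r$): $\mathcal{I}\models\mathrm{sp}(U)\to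 D_\Pi\mathrm{sp}(U)$; if $D_A\mathrm{sp}(U)$ holds at a point there are open $V_r$ with $\bigcup_{r\in A}V_r=U$ and $K_r\mathrm{sp}(V_r)$ there; $\mathcal{I}\models\mathrm{sp}(U)\to\Box\mathrm{sp}(U)$; $\mathcal{I}\models K_r\mathrm{sp}(U)\to\Box K_r\mathrm{sp}(U)$. Found and secure conditions, for any run and intruder path $\alpha:[0,1]\to X$ with trace $\mathrm{tr}(\alpha)=\{(\alpha(t),t)\}$: (detection agency) $\mathrm{FOUND}$ holds at time $t$ iff some robot's observation region at time $t$ intersects $\alpha$ or $\mathrm{FOUND}$ held at an earlier time; (observation correctness) if $U\subseteq C$ meets $\mathrm{tr}(\alpha)$ then $\neg\mathrm{sp}(U)$; (securement) for every continuous $f:X\to[0,1]$ and region $U\subseteq C$ with $\mathrm{tr}(f)=\{(x,f(x))\}\subseteq U$, $\mathrm{sp}(U)\to\mathrm{SECURE}$; (completion) $\mathcal{I}\models(\mathrm{SECURE}\to\Box\neg\mathrm{FOUND})\wedge(\mathrm{FOUND}\to\Box\neg\mathrm{SECURE})$. Manifold liveness for $\rho$: there is a continuous $f_\rho:X\to[0,1]$ and a collection $\mathcal{U}$ of open subsets of $C$ with $\mathrm{tr}(f_\rho)\subseteq\bigcup\mathcal{U}$ and $\mathcal{I},\rho\models\Diamond\mathrm{sp}(U)$ for each $U\in\mathcal{U}$. *)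

theory Defs
  imports "HOL-Analysis.Analysis"
begin

type_synonym 'g run = "nat \<Rightarrow> 'g"

(* Discrete time indexes the steps of a run; the real coordinate of a point of spacetime is
   the normalized physical time. *)
type_synonym 'k spacetime = "(real ^ 'k) \<times> real"

datatype 'c atom = Sp "'c set" | Found | Secure

datatype ('c, 'r) fm =
    Atom "'c atom"
  | Neg "('c, 'r) fm"
  | Conj "('c, 'r) fm" "('c, 'r) fm"
  | Disj "('c, 'r) fm" "('c, 'r) fm"
  | Imp "('c, 'r) fm" "('c, 'r) fm"
  | Know 'r "('c, 'r) fm"
  | Dist "'r set" "('c, 'r) fm"
  | Ev "('c, 'r) fm"

abbreviation Alw :: "('c, 'r) fm \<Rightarrow> ('c, 'r) fm" where
  "Alw p \<equiv> Neg (Ev (Neg p))"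

abbreviation sp :: "'c set \<Rightarrow> ('c, 'r) fm" where "sp U \<equiv> Atom (Sp U)"
abbreviation FOUND :: "('c, 'r) fm" where "FOUND \<equiv> Atom Found"
abbreviation SECURE :: "('c, 'r) fm" where "SECURE \<equiv> Atom Secure"

(* Epistemic states and truth values of atoms are attached to points (run, time) rather than
   to global configurations: FOUND, for example, depends on the past of the run. *)
record ('g, 'r, 'e, 'c) interpreted_system =
  runs :: "'g run set"
  epi :: "'r \<Rightarrow> 'g run \<times> nat \<Rightarrow> 'e"
  val :: "'g run \<times> nat \<Rightarrow> 'c atom set"

definition points :: "('g, 'r, 'e, 'c, 'z) interpreted_system_scheme \<Rightarrow> ('g run \<times> nat) set" where
  "points I = runs I \<times> UNIV"

definition indist :: "('g, 'r, 'e, 'c, 'z) interpreted_system_scheme \<Rightarrow> 'r \<Rightarrow>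
    (('g run \<times> nat) \<times> ('g run \<times> nat)) set" where
  "indist I r = {(p, q). p \<in> points I \<and> q \<in> points I \<and> epi I r p = epi I r q}"

definition dist_indist :: "('g, 'r, 'e, 'c, 'z) interpreted_system_scheme \<Rightarrow> 'r set \<Rightarrow>
    (('g run \<times> nat) \<times> ('g run \<times> nat)) set" where
  "dist_indist I A = (points I \<times> points I) \<inter> (\<Inter>r\<in>A. indist I r)"

primrec sat :: "('g, 'r, 'e, 'c, 'z) interpreted_system_scheme \<Rightarrow> 'g run \<times> nat \<Rightarrow>
    ('c, 'r) fm \<Rightarrow> bool" where
  "sat I p (Atom a) \<longleftrightarrow> a \<in> val I p"
| "sat I p (Neg \<phi>) \<longleftrightarrow> \<not> sat I p \<phi>"
| "sat I p (Conj \<phi> \<psi>) \<longleftrightarrow> sat I p \<phi> \<and> sat I p \<psi>"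
| "sat I p (Disj \<phi> \<psi>) \<longleftrightarrow> sat I p \<phi> \<or> sat I p \<psi>"
| "sat I p (Imp \<phi> \<psi>) \<longleftrightarrow> (sat I p \<phi> \<longrightarrow> sat I p \<psi>)"
| "sat I p (Know r \<phi>) \<longleftrightarrow> (\<forall>q. (p, q) \<in> indist I r \<longrightarrow> sat I q \<phi>)"
| "sat I p (Dist A \<phi>) \<longleftrightarrow> (\<forall>q. (p, q) \<in> dist_indist I A \<longrightarrow> sat I q \<phi>)"
| "sat I p (Ev \<phi>) \<longleftrightarrow> (\<exists>t\<ge>snd p. sat I (fst p, t) \<phi>)"

definition valid :: "('g, 'r, 'e, 'c, 'z) interpreted_system_scheme \<Rightarrow> ('c, 'r) fm \<Rightarrow> bool" where
  "valid I \<phi> \<longleftrightarrow> (\<forall>p\<in>points I. sat I p \<phi>)"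

definition run_sat :: "('g, 'r, 'e, 'c, 'z) interpreted_system_scheme \<Rightarrow> 'g run \<Rightarrow>
    ('c, 'r) fm \<Rightarrow> bool" where
  "run_sat I \<rho> \<phi> \<longleftrightarrow> sat I (\<rho>, 0) \<phi>"

lemma run_sat_Ev: "run_sat I \<rho> (Ev \<phi>) \<longleftrightarrow> (\<exists>t. sat I (\<rho>, t) \<phi>)"
  by (simp add: run_sat_def)

(* The region observed by a robot at a discrete time is a set of points of spacetime.
   A run has at most one intruder; None means that it has none. *)
record ('g, 'r, 'e, 'k::finite) surveillance_system =
  "('g, 'r, 'e, 'k::finite spacetime) interpreted_system" +
  surv_space :: "(real ^ 'k::finite) set"
  robots :: "'r set"
  obs :: "'g run \<Rightarrow> 'r \<Rightarrow> nat \<Rightarrow> 'k spacetime set"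
  intruder :: "'g run \<Rightarrow> (real \<Rightarrow> real ^ 'k) option"

definition cylinder :: "('g, 'r, 'e, 'k::finite, 'z) surveillance_system_scheme \<Rightarrow> 'k spacetime set" where
  "cylinder S = surv_space S \<times> {0..1}"

definition region :: "('g, 'r, 'e, 'k::finite, 'z) surveillance_system_scheme \<Rightarrow>
    'k spacetime set \<Rightarrow> bool" where
  "region S U \<longleftrightarrow> openin (top_of_set (cylinder S)) U"

definition path_trace :: "(real \<Rightarrow> real ^ 'k) \<Rightarrow> 'k spacetime set" where
  "path_trace \<alpha> = {(\<alpha> t, t) |t. t \<in> {0..1}}"

definition fun_trace :: "(real ^ 'k) set \<Rightarrow> (real ^ 'k \<Rightarrow> real) \<Rightarrow> 'k spacetime set" where
  "fun_trace X f = {(x, f x) |x. x \<in> X}"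

(* Taking \<V> empty, the last clause makes sp {} valid; it is needed for empty spaces. *)
definition robot_system :: "('g, 'r, 'e, 'k::finite, 'z) surveillance_system_scheme \<Rightarrow> bool" where
  "robot_system S \<longleftrightarrow>
     finite (robots S) \<and>
     compact (surv_space S) \<and> surv_space S \<subseteq> cbox 0 1 \<and>
     (\<forall>\<rho>\<in>runs S. \<forall>r\<in>robots S. \<forall>t. obs S \<rho> r t \<subseteq> cylinder S) \<and>
     (\<forall>\<rho>\<in>runs S. \<forall>\<alpha>. intruder S \<rho> = Some \<alpha> \<longrightarrow> path \<alpha> \<and> path_image \<alpha> \<subseteq> surv_space S) \<and>
     (\<forall>U V. region S U \<and> region S V \<and> U \<subseteq> V \<longrightarrow> valid S (Imp (sp V) (sp U))) \<and>
     (\<forall>\<V>. finite \<V> \<and> (\<forall>V\<in>\<V>. region S V) \<longrightarrow>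
        (\<forall>p\<in>points S. (\<forall>V\<in>\<V>. sat S p (sp V)) \<longrightarrow> sat S p (sp (\<Union>\<V>))))"

definition simple_exploration ::
    "('g, 'r, 'e, 'k::finite, 'z) surveillance_system_scheme \<Rightarrow> bool" where
  "simple_exploration S \<longleftrightarrow>
     (\<forall>U. region S U \<longrightarrow> valid S (Imp (sp U) (Dist (robots S) (sp U)))) \<and>
     (\<forall>U A. region S U \<and> A \<subseteq> robots S \<longrightarrow>
        (\<forall>p\<in>points S. sat S p (Dist A (sp U)) \<longrightarrow>
           (\<exists>V. (\<forall>r\<in>A. region S (V r) \<and> sat S p (Know r (sp (V r)))) \<and> (\<Union>r\<in>A. V r) = U))) \<and>
     (\<forall>U. region S U \<longrightarrow> valid S (Imp (sp U) (Alw (sp U)))) \<and>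
     (\<forall>U. \<forall>r\<in>robots S. region S U \<longrightarrow>
        valid S (Imp (Know r (sp U)) (Alw (Know r (sp U)))))"

definition detection_agency ::
    "('g, 'r, 'e, 'k::finite, 'z) surveillance_system_scheme \<Rightarrow> bool" where
  "detection_agency S \<longleftrightarrow>
     (\<forall>\<rho>\<in>runs S. \<forall>\<alpha>. intruder S \<rho> = Some \<alpha> \<longrightarrow>
        (\<forall>t. sat S (\<rho>, t) FOUND \<longleftrightarrow>
           (\<exists>r\<in>robots S. obs S \<rho> r t \<inter> path_trace \<alpha> \<noteq> {}) \<or>
           (\<exists>t'<t. sat S (\<rho>, t') FOUND)))"

definition observation_correctness ::
    "('g, 'r, 'e, 'k::finite, 'z) surveillance_system_scheme \<Rightarrow> bool" where
  "observation_correctness S \<longleftrightarrow>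
     (\<forall>\<rho>\<in>runs S. \<forall>\<alpha>. intruder S \<rho> = Some \<alpha> \<longrightarrow>
        (\<forall>U t. region S U \<and> U \<inter> path_trace \<alpha> \<noteq> {} \<longrightarrow> sat S (\<rho>, t) (Neg (sp U))))"

definition securement ::
    "('g, 'r, 'e, 'k::finite, 'z) surveillance_system_scheme \<Rightarrow> bool" where
  "securement S \<longleftrightarrow>
     (\<forall>f U. continuous_on (surv_space S) f \<and> f ` surv_space S \<subseteq> {0..1} \<and>
        region S U \<and> fun_trace (surv_space S) f \<subseteq> U \<longrightarrow> valid S (Imp (sp U) SECURE))"

definition completion ::
    "('g, 'r, 'e, 'k::finite, 'z) surveillance_system_scheme \<Rightarrow> bool" where
  "completion S \<longleftrightarrow>
     valid S (Conj (Imp SECURE (Alw (Neg FOUND))) (Imp FOUND (Alw (Neg SECURE))))"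

definition found_and_secure ::
    "('g, 'r, 'e, 'k::finite, 'z) surveillance_system_scheme \<Rightarrow> bool" where
  "found_and_secure S \<longleftrightarrow>
     detection_agency S \<and> observation_correctness S \<and> securement S \<and> completion S"

definition manifold_liveness ::
    "('g, 'r, 'e, 'k::finite, 'z) surveillance_system_scheme \<Rightarrow> 'g run \<Rightarrow> bool" where
  "manifold_liveness S \<rho> \<longleftrightarrow>
     (\<exists>f \<U>. continuous_on (surv_space S) f \<and> f ` surv_space S \<subseteq> {0..1} \<and>
        (\<forall>U\<in>\<U>. region S U) \<and> fun_trace (surv_space S) f \<subseteq> \<Union>\<U> \<and>
        (\<forall>U\<in>\<U>. run_sat S \<rho> (Ev (sp U))))"

end

(* The graph of f is compact, so finitely many of the regions explored along the run cover it.
   Exploration is never lost, so these regions are all explored at one common time, when their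
   union is explored and securement applies. *)
theory Submission
  imports Defs
begin

text \<open>The graph is the image of \<open>X\<close> under the continuous map sending
  \<open>x\<close> to \<open>(x, f x)\<close>.\<close>

lemma compact_fun_trace:
  assumes "compact X" "continuous_on X f"
  shows "compact (fun_trace X f)"
proof -
  have "fun_trace X f = (\<lambda>x. (x, f x)) ` X"
    by (auto simp: fun_trace_def)
  then show ?thesis
    using assms by (auto intro!: compact_continuous_image continuous_intros)
qed

lemma sp_Union:
  assumes "robot_system S" "finite \<V>" "\<And>V. V \<in> \<V> \<Longrightarrow> region S V"
    and "p \<in> points S" "\<And>V. V \<in> \<V> \<Longrightarrow> sat S p (sp V)"
  shows "sat S p (sp (\<Union>\<V>))"
proof -
  have "\<forall>\<V>. finite \<V> \<and> (\<forall>V\<in>\<V>. region S V) \<longrightarrow>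
      (\<forall>p\<in>points S. (\<forall>V\<in>\<V>. sat S p (sp V)) \<longrightarrow> sat S p (sp (\<Union>\<V>)))"
    using assms(1) unfolding robot_system_def by (elim conjE)
  from this[rule_format, of \<V> p] show ?thesis
    using assms(2-5) by simp
qed

text \<open>Exploration is stable by the third clause of \<open>simple_exploration\<close>.
  \<open>Alw\<close> is the dual of \<open>Ev\<close>, whose times include the present one, so the
  bound \<open>s \<le> t\<close> need not be strict.\<close>

lemma sp_persistent:
  assumes "simple_exploration S" "\<rho> \<in> runs S" "region S U"
    and "sat S (\<rho>, s) (sp U)" "s \<le> t"
  shows "sat S (\<rho>, t) (sp U)"
proof -
  have "valid S (Imp (sp U) (Alw (sp U)))"
    using assms(1,3) by (simp add: simple_exploration_def)
  moreover have "(\<rho>, s) \<in> points S"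
    using assms(2) by (simp add: points_def)
  ultimately show ?thesis
    using assms(4,5) by (auto simp: valid_def)
qed

text \<open>Each member of \<open>\<V>\<close> is explored at a time of its own; by persistence all
  of them are still explored at the latest of these times, which exists because \<open>\<V>\<close>
  is finite.\<close>

lemma finitely_many_sp_simultaneous:
  assumes "simple_exploration S" "\<rho> \<in> runs S" "finite \<V>"
    and "\<And>V. V \<in> \<V> \<Longrightarrow> region S V"
    and "\<And>V. V \<in> \<V> \<Longrightarrow> run_sat S \<rho> (Ev (sp V))"
  obtains t where "\<And>V. V \<in> \<V> \<Longrightarrow> sat S (\<rho>, t) (sp V)"
proof -
  obtain T where T: "\<And>V. V \<in> \<V> \<Longrightarrow> sat S (\<rho>, T V) (sp V)"
    using assms(5) unfolding run_sat_Ev by metis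
  \<comment> \<open>For empty \<open>\<V>\<close> the value of \<open>Max\<close> is unspecified,
    but then nothing is claimed about it.\<close>
  have "sat S (\<rho>, Max (T ` \<V>)) (sp V)" if "V \<in> \<V>" for V
    using sp_persistent[OF assms(1,2) assms(4)[OF that] T[OF that]] assms(3) that by simp
  then show thesis by (rule that)
qed

theorem mainTheorem8:
  fixes S :: "('g, 'r, 'e, 'k::finite) surveillance_system" and \<rho> :: "'g run"
  assumes "robot_system S"
    and "simple_exploration S"
    and "found_and_secure S"
    and "\<rho> \<in> runs S"
    and "manifold_liveness S \<rho>"
  shows "run_sat S \<rho> (Disj (Ev FOUND) (Ev SECURE))"
proof -
  obtain f \<U> where f: "continuous_on (surv_space S) f" "f ` surv_space S \<subseteq> {0..1}"
    and \<U>: "\<forall>U\<in>\<U>. region S U" "fun_trace (surv_space S) f \<subseteq> \<Union>\<U>"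
      "\<forall>U\<in>\<U>. run_sat S \<rho> (Ev (sp U))"
    using assms(5) unfolding manifold_liveness_def by (elim exE conjE)
  have "compact (fun_trace (surv_space S) f)"
    using assms(1) f(1) by (intro compact_fun_trace) (simp_all add: robot_system_def)
  moreover have "fun_trace (surv_space S) f \<subseteq> cylinder S"
    using f(2) by (auto simp: fun_trace_def cylinder_def)
  \<comment> \<open>Regions are open only relative to the cylinder, so compactness is moved from the
    ambient space to this subspace before a finite subcover is taken.\<close>
  ultimately have "compactin (top_of_set (cylinder S)) (fun_trace (surv_space S) f)"
    by (simp add: compactin_subtopology)
  then have "\<exists>\<V>. finite \<V> \<and> \<V> \<subseteq> \<U> \<and> fun_trace (surv_space S) f \<subseteq> \<Union>\<V>"
    using \<U>(1,2) by (simp only: compactin_def region_def)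
  then obtain \<V> where \<V>: "finite \<V>" "\<V> \<subseteq> \<U>" "fun_trace (surv_space S) f \<subseteq> \<Union>\<V>"
    by (elim exE conjE)
  then have regions: "\<And>V. V \<in> \<V> \<Longrightarrow> region S V"
    using \<U>(1) by blast
  obtain t where t: "\<And>V. V \<in> \<V> \<Longrightarrow> sat S (\<rho>, t) (sp V)"
    using finitely_many_sp_simultaneous[OF assms(2,4) \<V>(1) regions] \<U>(3) \<V>(2) by blast
  have point: "(\<rho>, t) \<in> points S"
    using assms(4) by (simp add: points_def)
  \<comment> \<open>If the surveillance space is empty, \<open>\<V>\<close> may be empty too; this
    is then the fact \<open>sp {}\<close>.\<close>
  have union: "sat S (\<rho>, t) (sp (\<Union>\<V>))"
    by (rule sp_Union[OF assms(1) \<V>(1) regions point t])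
  have "region S (\<Union>\<V>)"
    using regions unfolding region_def by (rule openin_Union)
  moreover have "securement S"
    using assms(3) by (simp add: found_and_secure_def)
  ultimately have "valid S (Imp (sp (\<Union>\<V>)) SECURE)"
    using f \<V>(3) unfolding securement_def by (elim allE impE) (intro conjI)
  then have "sat S (\<rho>, t) SECURE"
    using union point by (simp add: valid_def)
  \<comment> \<open>The second disjunct holds, with witness \<open>t\<close>: evaluated at time 0,
    \<open>Ev\<close> ranges over the whole run.\<close>
  then show ?thesis
    by (auto simp: run_sat_def)
qed

end
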